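(* Let $M_P=\langle M,P(M)\rangle$ be a small model of $T^2$ satisfying the Extension Property (for $\mathcal L$-1-types): for every very small $A\subset M$ and every $q\in S^1_1(A)$ there is $b\in M$ realizing $q$ with $b\downarrow_A P(M)$. Then $M_P$ satisfies the Extension Property for $\mathcal L$-types of very small length: for every very small $A\subset M$ and every complete $\mathcal L$-type $q$ over $A$ in a very small tuple of variables, there is a tuple $\bar b$ in $M$ realizing $q$ with $\bar b\downarrow_A P(M)$.
   Context: $T$ is a complete first-order theory in a language $\mathcal L$ and $\mathfrak C$ is a monster model of $T$; "small" means of cardinality smaller than the monstrosity of $\mathfrak C$ (its degree of saturation and strong homogeneity); tuples have small length. Juxtaposition denotes union, and tuples are identified with their sets of entries. An independence relation on $\mathfrak C$ is a ternary relation $A\downarrow_C B$ on small subsets of $\mathfrak C$ such that for all small $A,B,C,D$: (Invariance) $A\downarrow_B C\Rightarrow\sigma(A)\downarrow_{\sigma(B)}\sigma(C)$ for $\sigma\in\mathrm{Aut}(\mathfrak C)$; (Normality) $A\downarrow_C B\Rightarrow AC\downarrow_C B$; (Symmetry) $A\downarrow_B C\Rightarrow C\downarrow_B A$; (Transitivity) if $B\subseteq C\subseteq D$, then $A\downarrow_B D$ iff $A\downarrow_B C$ and $A\downarrow_C D$; (Finite character) $A\downarrow_B C$ iff $A_0\downarrow_B C$ for all finite $A_0\subseteq A$; (Extension) there is $A'\equiv_B A$ with $A'\downarrow_B C$; (Local character) there is a small cardinal $\lambda$ depending only on $\downarrow$ such that for all small $A,C$ there is $C_0\subseteq C$ with $|C_0|<\lambda+|A|^+$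 and $A\downarrow_{C_0}C$. Fix an independence relation $\downarrow$ on $\mathfrak C$. $\kappa_0$ is the least regular cardinal $\mu$ such that for every finite tuple $\bar a$ and small set $B$ there is $B_0\subseteq B$ with $|B_0|<\mu$ and $\bar a\downarrow_{B_0}B$. $\mathcal L^2=\mathcal L\cup\{P\}$ with $P$ a new unary predicate; $T^2$ is the theory of all expansions of $T$ to $\mathcal L^2$. A superscript 1 on a model-theoretic notion refers to $\mathcal L$; $S^1_1(A)$ is the set of complete $\mathcal L$-types over $A$ in one variable. Models of $T$ are elementary substructures of $\mathfrak C$; a model of $T^2$ is written $M_P=\langle M,P(M)\rangle$. Fix a small cardinal $\kappa>\max(\kappa_0,|T|)$; a set or tuple is very small if its cardinality is $<\kappa$. *)

theory Defs
  imports Main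
begin

unbundle cardinal_syntax

section \<open>First-order logic\<close>

record ('f, 'r) lang =
  funs :: "'f set"
  far :: "'f \<Rightarrow> nat"
  rels :: "'r set"
  rar :: "'r \<Rightarrow> nat"

datatype ('f, 'v) trm = Var 'v | Fn 'f "('f, 'v) trm list"

datatype ('f, 'r, 'v) fm =
    Eq "('f, 'v) trm" "('f, 'v) trm"
  | Rel 'r "('f, 'v) trm list"
  | Neg "('f, 'r, 'v) fm"
  | Conj "('f, 'r, 'v) fm" "('f, 'r, 'v) fm"
  | Ex 'v "('f, 'r, 'v) fm"

fun wf_trm :: "('f, 'r) lang \<Rightarrow> ('f, 'v) trm \<Rightarrow> bool" where
  "wf_trm L (Var v) \<longleftrightarrow> True"
| "wf_trm L (Fn f ts) \<longleftrightarrow> f \<in> funs L \<and> length ts = far L f \<and> (\<forall>t\<in>set ts. wf_trm L t)"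

fun wf_fm :: "('f, 'r) lang \<Rightarrow> ('f, 'r, 'v) fm \<Rightarrow> bool" where
  "wf_fm L (Eq s t) \<longleftrightarrow> wf_trm L s \<and> wf_trm L t"
| "wf_fm L (Rel r ts) \<longleftrightarrow> r \<in> rels L \<and> length ts = rar L r \<and> (\<forall>t\<in>set ts. wf_trm L t)"
| "wf_fm L (Neg \<phi>) \<longleftrightarrow> wf_fm L \<phi>"
| "wf_fm L (Conj \<phi> \<psi>) \<longleftrightarrow> wf_fm L \<phi> \<and> wf_fm L \<psi>"
| "wf_fm L (Ex v \<phi>) \<longleftrightarrow> wf_fm L \<phi>"

fun fv_trm :: "('f, 'v) trm \<Rightarrow> 'v set" where
  "fv_trm (Var v) = {v}"
| "fv_trm (Fn f ts) = (\<Union>t\<in>set ts. fv_trm t)"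

fun fv :: "('f, 'r, 'v) fm \<Rightarrow> 'v set" where
  "fv (Eq s t) = fv_trm s \<union> fv_trm t"
| "fv (Rel r ts) = (\<Union>t\<in>set ts. fv_trm t)"
| "fv (Neg \<phi>) = fv \<phi>"
| "fv (Conj \<phi> \<psi>) = fv \<phi> \<union> fv \<psi>"
| "fv (Ex v \<phi>) = fv \<phi> - {v}"

record ('f, 'r, 'm) fo_struct =
  univ :: "'m set"
  fint :: "'f \<Rightarrow> 'm list \<Rightarrow> 'm"
  rint :: "'r \<Rightarrow> 'm list \<Rightarrow> bool"

definition is_struct :: "('f, 'r) lang \<Rightarrow> ('f, 'r, 'm) fo_struct \<Rightarrow> bool" where
  "is_struct L S \<longleftrightarrow> univ S \<noteq> {} \<and>
     (\<forall>f\<in>funs L. \<forall>xs. set xs \<subseteq> univ S \<and> length xs = far L f \<longrightarrow> fint S f xs \<in> univ S)"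

fun eval :: "('f, 'r, 'm) fo_struct \<Rightarrow> ('v \<Rightarrow> 'm) \<Rightarrow> ('f, 'v) trm \<Rightarrow> 'm" where
  "eval S e (Var v) = e v"
| "eval S e (Fn f ts) = fint S f (map (eval S e) ts)"

fun sat :: "('f, 'r, 'm) fo_struct \<Rightarrow> ('v \<Rightarrow> 'm) \<Rightarrow> ('f, 'r, 'v) fm \<Rightarrow> bool" where
  "sat S e (Eq s t) \<longleftrightarrow> eval S e s = eval S e t"
| "sat S e (Rel r ts) \<longleftrightarrow> rint S r (map (eval S e) ts)"
| "sat S e (Neg \<phi>) \<longleftrightarrow> \<not> sat S e \<phi>"
| "sat S e (Conj \<phi> \<psi>) \<longleftrightarrow> sat S e \<phi> \<and> sat S e \<psi>"
| "sat S e (Ex v \<phi>) \<longleftrightarrow> (\<exists>x\<in>univ S. sat S (e(v := x)) \<phi>)"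

definition sentences :: "('f, 'r) lang \<Rightarrow> ('f, 'r, nat) fm set" where
  "sentences L = {\<phi>. wf_fm L \<phi> \<and> fv \<phi> = {}}"

definition is_model ::
    "('f, 'r) lang \<Rightarrow> ('f, 'r, nat) fm set \<Rightarrow> ('f, 'r, 'm) fo_struct \<Rightarrow> bool" where
  "is_model L T S \<longleftrightarrow> is_struct L S \<and>
     (\<forall>\<phi>\<in>T. \<forall>e. range e \<subseteq> univ S \<longrightarrow> sat S e \<phi>)"

text \<open>A complete theory contains each sentence or its negation, so that \<open>|T|\<close> is the number of
  sentences, which is \<open>|L|\<close> plus aleph-zero. Consistency is not part of this definition; it is
  only used for theories that come with a model (the monster model).\<close>

definition complete_theory :: "('f, 'r) lang \<Rightarrow> ('f, 'r, nat) fm set \<Rightarrow> bool" where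
  "complete_theory L T \<longleftrightarrow> T \<subseteq> sentences L \<and> (\<forall>\<phi>\<in>sentences L. \<phi> \<in> T \<or> Neg \<phi> \<in> T)"

definition elementary_substruct ::
    "('f, 'r) lang \<Rightarrow> ('f, 'r, 'm) fo_struct \<Rightarrow> ('f, 'r, 'm) fo_struct \<Rightarrow> bool" where
  "elementary_substruct L M S \<longleftrightarrow>
     is_struct L M \<and> is_struct L S \<and> univ M \<subseteq> univ S \<and>
     (\<forall>f\<in>funs L. \<forall>xs. set xs \<subseteq> univ M \<and> length xs = far L f \<longrightarrow> fint M f xs = fint S f xs) \<and>
     (\<forall>r\<in>rels L. \<forall>xs. set xs \<subseteq> univ M \<and> length xs = rar L r \<longrightarrow> rint M r xs = rint S r xs) \<and>
     (\<forall>(\<phi> :: ('f, 'r, nat) fm) e. wf_fm L \<phi> \<and> range e \<subseteq> univ M \<longrightarrow> sat M e \<phi> = sat S e \<phi>)"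

definition automorphism ::
    "('f, 'r) lang \<Rightarrow> ('f, 'r, 'm) fo_struct \<Rightarrow> ('m \<Rightarrow> 'm) \<Rightarrow> bool" where
  "automorphism L S \<sigma> \<longleftrightarrow> bij_betw \<sigma> (univ S) (univ S) \<and>
     (\<forall>f\<in>funs L. \<forall>xs. set xs \<subseteq> univ S \<and> length xs = far L f \<longrightarrow>
        \<sigma> (fint S f xs) = fint S f (map \<sigma> xs)) \<and>
     (\<forall>r\<in>rels L. \<forall>xs. set xs \<subseteq> univ S \<and> length xs = rar L r \<longrightarrow>
        rint S r xs = rint S r (map \<sigma> xs))"

section \<open>Types over sets of parameters\<close>

text \<open>The language \<open>L(A)\<close> has a new constant symbol \<open>Inr a\<close> for every \<open>a \<in> A\<close>, which denotes \<open>a\<close>.\<close>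

definition lang_const :: "('f, 'r) lang \<Rightarrow> 'm set \<Rightarrow> ('f + 'm, 'r) lang" where
  "lang_const L A = \<lparr>funs = Inl ` funs L \<union> Inr ` A, far = case_sum (far L) (\<lambda>_. 0),
     rels = rels L, rar = rar L\<rparr>"

definition struct_const :: "('f, 'r, 'm) fo_struct \<Rightarrow> ('f + 'm, 'r, 'm) fo_struct" where
  "struct_const S = \<lparr>univ = univ S, fint = case_sum (fint S) (\<lambda>a _. a), rint = rint S\<rparr>"

text \<open>A tuple of length \<open>I\<close> is a function on the index set \<open>I\<close>, and its set of entries is the
  image of \<open>I\<close>. The variables of a type in a tuple of variables of length \<open>I\<close> are
  \<open>Inl i\<close> for \<open>i \<in> I\<close>; the variables \<open>Inr n\<close> only serve as bound variables.\<close>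

definition formulas_over ::
    "('f, 'r) lang \<Rightarrow> 'm set \<Rightarrow> 'i set \<Rightarrow> ('f + 'm, 'r, 'i + nat) fm set" where
  "formulas_over L A I = {\<phi>. wf_fm (lang_const L A) \<phi> \<and> fv \<phi> \<subseteq> Inl ` I}"

definition holds_at ::
    "('f, 'r, 'm) fo_struct \<Rightarrow> ('i \<Rightarrow> 'm) \<Rightarrow> ('f + 'm, 'r, 'i + nat) fm \<Rightarrow> bool" where
  "holds_at S b \<phi> \<longleftrightarrow> sat (struct_const S) (case_sum b (\<lambda>_. undefined)) \<phi>"

definition realizes ::
    "('f, 'r, 'm) fo_struct \<Rightarrow> ('i \<Rightarrow> 'm) \<Rightarrow> ('f + 'm, 'r, 'i + nat) fm set \<Rightarrow> bool" where
  "realizes S b q \<longleftrightarrow> (\<forall>\<phi>\<in>q. holds_at S b \<phi>)"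

definition tp ::
    "('f, 'r) lang \<Rightarrow> ('f, 'r, 'm) fo_struct \<Rightarrow> 'm set \<Rightarrow> 'i set \<Rightarrow> ('i \<Rightarrow> 'm) \<Rightarrow>
     ('f + 'm, 'r, 'i + nat) fm set" where
  "tp L S A I a = {\<phi>\<in>formulas_over L A I. holds_at S a \<phi>}"

definition complete_types ::
    "('f, 'r) lang \<Rightarrow> ('f, 'r, 'm) fo_struct \<Rightarrow> 'm set \<Rightarrow> 'i set \<Rightarrow>
     ('f + 'm, 'r, 'i + nat) fm set set" where
  "complete_types L S A I = {q. q \<subseteq> formulas_over L A I \<and>
     (\<forall>q0. q0 \<subseteq> q \<and> finite q0 \<longrightarrow> (\<exists>b. b ` I \<subseteq> univ S \<and> realizes S b q0)) \<and>
     (\<forall>\<phi>\<in>formulas_over L A I. \<phi> \<in> q \<or> Neg \<phi> \<in> q)}"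

section \<open>The monster model\<close>

text \<open>Here \<open>\<mu>\<close> is the monstrosity. Cardinals are cardinal orders on the type \<open>'k\<close>. As \<open>\<mu>\<close> is itself
  one, every cardinal below \<open>\<mu>\<close> occurs among them.\<close>

definition small :: "'k rel \<Rightarrow> 'm set \<Rightarrow> bool" where
  "small \<mu> A \<longleftrightarrow> |A| <o \<mu>"

definition monster_model ::
    "('f, 'r) lang \<Rightarrow> ('f, 'r, nat) fm set \<Rightarrow> 'k rel \<Rightarrow> ('f, 'r, 'm) fo_struct \<Rightarrow> bool" where
  "monster_model L T \<mu> C \<longleftrightarrow>
     is_model L T C \<and> Cinfinite \<mu> \<and>
     (\<forall>A. A \<subseteq> univ C \<and> small \<mu> A \<longrightarrow>
        (\<forall>q\<in>complete_types L C A (UNIV :: unit set). \<exists>b. b () \<in> univ C \<and> realizes C b q)) \<and>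
     (\<forall>A g. A \<subseteq> univ C \<and> small \<mu> A \<and> g ` A \<subseteq> univ C \<and> tp L C {} A id = tp L C {} A g \<longrightarrow>
        (\<exists>\<sigma>. automorphism L C \<sigma> \<and> (\<forall>a\<in>A. \<sigma> a = g a)))"

section \<open>Independence relations\<close>

text \<open>\<open>ind A B D\<close> means that \<open>A\<close> is independent from \<open>D\<close> over \<open>B\<close>; the base is the middle argument.
  Only its values on small subsets of the monster model matter.\<close>

definition independence_relation ::
    "('f, 'r) lang \<Rightarrow> 'k rel \<Rightarrow> ('f, 'r, 'm) fo_struct \<Rightarrow>
     ('m set \<Rightarrow> 'm set \<Rightarrow> 'm set \<Rightarrow> bool) \<Rightarrow> bool" where
  "independence_relation L \<mu> C ind \<longleftrightarrow>
    (let sm = (\<lambda>A. A \<subseteq> univ C \<and> small \<mu> A) in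
     \<comment> \<open>Invariance\<close>
     (\<forall>A B D \<sigma>. sm A \<and> sm B \<and> sm D \<and> automorphism L C \<sigma> \<and> ind A B D \<longrightarrow>
        ind (\<sigma> ` A) (\<sigma> ` B) (\<sigma> ` D)) \<and>
     \<comment> \<open>Normality\<close>
     (\<forall>A B D. sm A \<and> sm B \<and> sm D \<and> ind A B D \<longrightarrow> ind (A \<union> B) B D) \<and>
     \<comment> \<open>Symmetry\<close>
     (\<forall>A B D. sm A \<and> sm B \<and> sm D \<and> ind A B D \<longrightarrow> ind D B A) \<and>
     \<comment> \<open>Transitivity\<close>
     (\<forall>A B D E. sm A \<and> sm B \<and> sm D \<and> sm E \<and> B \<subseteq> D \<and> D \<subseteq> E \<longrightarrow>
        (ind A B E \<longleftrightarrow> ind A B D \<and> ind A D E)) \<and>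
     \<comment> \<open>Finite character\<close>
     (\<forall>A B D. sm A \<and> sm B \<and> sm D \<longrightarrow>
        (ind A B D \<longleftrightarrow> (\<forall>A0. A0 \<subseteq> A \<and> finite A0 \<longrightarrow> ind A0 B D))) \<and>
     \<comment> \<open>Extension: \<open>A\<close> is enumerated by \<open>id\<close> and the set of the same type over \<open>B\<close> by \<open>g\<close>\<close>
     (\<forall>A B D. sm A \<and> sm B \<and> sm D \<longrightarrow>
        (\<exists>g. g ` A \<subseteq> univ C \<and> tp L C B A g = tp L C B A id \<and> ind (g ` A) B D)) \<and>
     \<comment> \<open>Local character\<close>
     (\<exists>l :: 'k rel. Card_order l \<and> l <o \<mu> \<and>
        (\<forall>A D. sm A \<and> sm D \<longrightarrow>
           (\<exists>D0. D0 \<subseteq> D \<and> |D0| <o l +c cardSuc |A| \<and> ind A D0 D))))"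

definition kappa0_bound ::
    "'k rel \<Rightarrow> ('f, 'r, 'm) fo_struct \<Rightarrow> ('m set \<Rightarrow> 'm set \<Rightarrow> 'm set \<Rightarrow> bool) \<Rightarrow> 'k rel \<Rightarrow> bool" where
  "kappa0_bound \<mu> C ind \<nu> \<longleftrightarrow>
     (\<forall>A B. A \<subseteq> univ C \<and> finite A \<and> B \<subseteq> univ C \<and> small \<mu> B \<longrightarrow>
        (\<exists>B0. B0 \<subseteq> B \<and> |B0| <o \<nu> \<and> ind A B0 B))"

definition is_kappa0 ::
    "'k rel \<Rightarrow> ('f, 'r, 'm) fo_struct \<Rightarrow> ('m set \<Rightarrow> 'm set \<Rightarrow> 'm set \<Rightarrow> bool) \<Rightarrow> 'k rel \<Rightarrow> bool" where
  "is_kappa0 \<mu> C ind \<nu> \<longleftrightarrow>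
     Cinfinite \<nu> \<and> regularCard \<nu> \<and> kappa0_bound \<mu> C ind \<nu> \<and>
     (\<forall>\<nu>' :: 'k rel. Cinfinite \<nu>' \<and> regularCard \<nu>' \<and> kappa0_bound \<mu> C ind \<nu>' \<longrightarrow> \<nu> \<le>o \<nu>')"

section \<open>Expansions by a unary predicate\<close>

text \<open>The new unary predicate is the relation symbol \<open>None\<close>.\<close>

definition lang_P :: "('f, 'r) lang \<Rightarrow> ('f, 'r option) lang" where
  "lang_P L = \<lparr>funs = funs L, far = far L, rels = insert None (Some ` rels L),
     rar = case_option 1 (rar L)\<rparr>"

definition reduct :: "('f, 'r option, 'm) fo_struct \<Rightarrow> ('f, 'r, 'm) fo_struct" where
  "reduct N = \<lparr>univ = univ N, fint = fint N, rint = (\<lambda>r. rint N (Some r))\<rparr>"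

definition P_set :: "('f, 'r option, 'm) fo_struct \<Rightarrow> 'm set" where
  "P_set N = {x\<in>univ N. rint N None [x]}"

text \<open>The theory of all expansions of models of \<open>T\<close>. The expansions range over structures on the
  type \<open>'m\<close>; if \<open>'m\<close> carries a \<open>|T|\<close>-saturated model of \<open>T\<close>, this is no restriction, by the
  Loewenheim-Skolem theorem.\<close>

definition theory_P ::
    "'m itself \<Rightarrow> ('f, 'r) lang \<Rightarrow> ('f, 'r, nat) fm set \<Rightarrow> ('f, 'r option, nat) fm set" where
  "theory_P (_ :: 'm itself) L T = {\<phi>\<in>sentences (lang_P L).
     \<forall>N :: ('f, 'r option, 'm) fo_struct.
       is_struct (lang_P L) N \<and> is_model L T (reduct N) \<longrightarrow>
       (\<forall>e. range e \<subseteq> univ N \<longrightarrow> sat N e \<phi>)}"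

definition small_model_P ::
    "('f, 'r) lang \<Rightarrow> ('f, 'r, nat) fm set \<Rightarrow> 'k rel \<Rightarrow> ('f, 'r, 'm) fo_struct \<Rightarrow>
     ('f, 'r option, 'm) fo_struct \<Rightarrow> bool" where
  "small_model_P L T \<mu> C N \<longleftrightarrow>
     is_model (lang_P L) (theory_P TYPE('m) L T) N \<and>
     elementary_substruct L (reduct N) C \<and> small \<mu> (univ N)"

text \<open>The Extension Property for types in a tuple of variables of length \<open>I\<close>.\<close>

definition extension_property ::
    "('f, 'r) lang \<Rightarrow> ('f, 'r, 'm) fo_struct \<Rightarrow> ('m set \<Rightarrow> 'm set \<Rightarrow> 'm set \<Rightarrow> bool) \<Rightarrow>
     'k rel \<Rightarrow> ('f, 'r option, 'm) fo_struct \<Rightarrow> 'i set \<Rightarrow> bool" where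
  "extension_property L C ind \<kappa> N I \<longleftrightarrow>
     (\<forall>A. A \<subseteq> univ N \<and> |A| <o \<kappa> \<longrightarrow>
        (\<forall>q\<in>complete_types L C A I.
           \<exists>b. b ` I \<subseteq> univ N \<and> realizes C b q \<and> ind (b ` I) A (P_set N)))"

end

theory Submission
  imports Defs
begin

text \<open>
  Fix a complete type \<open>q\<close> over \<open>A\<close> in the variables \<open>x\<^sub>i\<close>, \<open>i \<in> I\<close>. Call a partial tuple \<open>b\<close> on
  \<open>J \<subseteq> I\<close> with entries in \<open>M\<close> good if it satisfies the formulas of \<open>q\<close> in the variables indexed by
  \<open>J\<close> and is independent from \<open>P(M)\<close> over \<open>A\<close>. Goodness has finite character: a formula has
  finitely many free variables, and independence has finite character by axiom. By Zorn's lemma it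
  therefore suffices to start with the empty tuple, which is independent by Extension, and to add a
  single coordinate \<open>i\<close> to a good \<open>b\<close> on \<open>J\<close> (\<open>exists_total_of_finite_character\<close>).

  For this step, substitute \<open>b\<close> for the variables indexed by \<open>J\<close> in the formulas of \<open>q\<close> in the
  variables indexed by \<open>J \<union> {i}\<close>. This yields a complete \<open>1\<close>-type \<open>p\<close> over \<open>A \<union> b(J)\<close>
  (\<open>next_type_complete\<close>): it is finitely satisfiable, because \<open>q\<close> contains
  \<open>\<exists>x\<^sub>i. \<phi>\<close> for every conjunction \<open>\<phi>\<close> of its formulas, and \<open>b\<close> satisfies this formula if all its
  free variables are indexed by \<open>J\<close>. As \<open>A \<union> b(J)\<close> is very small, the Extension
  Property for \<open>1\<close>-types gives a realization \<open>d \<in> M\<close> of \<open>p\<close> that is independent from \<open>P(M)\<close> over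
  \<open>A \<union> b(J)\<close>. By normality, symmetry and transitivity, \<open>b(J) \<union> {d}\<close> is independent from \<open>P(M)\<close>
  over \<open>A\<close> (\<open>ind_insert\<close>).

  Since the types \<open>p\<close> are read off from \<open>q\<close> itself, neither automorphisms nor a realization of \<open>q\<close> in
  the monster model are needed.
\<close>

section \<open>Free variables and substitution\<close>

lemma finite_fv_trm: "finite (fv_trm t)"
  by (induction t) auto

lemma finite_fv: "finite (fv \<phi>)"
  by (induction \<phi>) (auto simp: finite_fv_trm)

lemma eval_cong: "(\<And>v. v \<in> fv_trm t \<Longrightarrow> e v = e' v) \<Longrightarrow> eval S e t = eval S e' t"
proof (induction t)
  case (Fn f ts)
  then have "map (eval S e) ts = map (eval S e') ts" by auto
  then show ?case by (simp only: eval.simps)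
qed simp

lemma sat_cong: "(\<And>v. v \<in> fv \<phi> \<Longrightarrow> e v = e' v) \<Longrightarrow> sat S e \<phi> = sat S e' \<phi>"
proof (induction \<phi> arbitrary: e e')
  case (Eq s t)
  then have "eval S e s = eval S e' s" "eval S e t = eval S e' t"
    by (auto intro!: eval_cong)
  then show ?case by simp
next
  case (Rel r ts)
  then have "map (eval S e) ts = map (eval S e') ts"
    by (auto intro!: eval_cong)
  then show ?case by (simp only: sat.simps)
next
  case (Neg \<phi>)
  have "sat S e \<phi> = sat S e' \<phi>"
    by (rule Neg.IH) (use Neg.prems in auto)
  then show ?case by simp
next
  case (Conj \<phi> \<psi>)
  have "sat S e \<phi> = sat S e' \<phi>"
    by (rule Conj.IH(1)) (use Conj.prems in auto)
  moreover have "sat S e \<psi> = sat S e' \<psi>"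
    by (rule Conj.IH(2)) (use Conj.prems in auto)
  ultimately show ?case by simp
next
  case (Ex v \<phi>)
  have "sat S (e(v := x)) \<phi> = sat S (e'(v := x)) \<phi>" for x
    by (rule Ex.IH) (use Ex.prems in auto)
  then show ?case by simp
qed

lemma holds_at_cong:
  assumes "fv \<phi> \<subseteq> Inl ` J" "\<And>j. j \<in> J \<Longrightarrow> b j = b' j"
  shows "holds_at S b \<phi> = holds_at S b' \<phi>"
  unfolding holds_at_def by (rule sat_cong) (use assms in auto)

text \<open>Simultaneous substitution of terms \<open>s v\<close> for the variables and \<open>c a\<close> for the constants that
  name parameters.\<close>

fun subst_trm ::
    "('v \<Rightarrow> ('f + 'm, 'w) trm) \<Rightarrow> ('m \<Rightarrow> ('f + 'm, 'w) trm) \<Rightarrow> ('f + 'm, 'v) trm \<Rightarrow>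
     ('f + 'm, 'w) trm" where
  "subst_trm s c (Var v) = s v"
| "subst_trm s c (Fn (Inl f) ts) = Fn (Inl f) (map (subst_trm s c) ts)"
| "subst_trm s c (Fn (Inr a) ts) = c a"

lemma wf_trm_Fn_const:
  "wf_trm (lang_const L A) (Fn (Inl f) ts) \<longleftrightarrow>
     f \<in> funs L \<and> length ts = far L f \<and> (\<forall>t\<in>set ts. wf_trm (lang_const L A) t)"
  "wf_trm (lang_const L A) (Fn (Inr a) ts) \<longleftrightarrow> a \<in> A \<and> ts = []"
  by (auto simp: lang_const_def)

lemma fint_struct_const_Inr [simp]: "fint (struct_const C) (Inr a) xs = a"
  by (simp add: struct_const_def)

lemma wf_subst_trm:
  assumes "wf_trm (lang_const L A) t" "\<forall>v\<in>fv_trm t. wf_trm (lang_const L B) (s v)"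
    "\<forall>a\<in>A. wf_trm (lang_const L B) (c a)"
  shows "wf_trm (lang_const L B) (subst_trm s c t)"
  using assms
proof (induction s c t rule: subst_trm.induct)
  case (2 s c f ts)
  then show ?case by (auto simp: wf_trm_Fn_const simp del: wf_trm.simps)
qed (auto simp: wf_trm_Fn_const simp del: wf_trm.simps)

lemma fv_subst_trm:
  assumes "wf_trm (lang_const L A) t" "\<forall>a\<in>A. fv_trm (c a) \<subseteq> X"
  shows "fv_trm (subst_trm s c t) \<subseteq> (\<Union>v\<in>fv_trm t. fv_trm (s v)) \<union> X"
  using assms
proof (induction s c t rule: subst_trm.induct)
  case (2 s c f ts)
  then show ?case by (fastforce simp: wf_trm_Fn_const simp del: wf_trm.simps)
qed (auto simp: wf_trm_Fn_const simp del: wf_trm.simps)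

lemma eval_subst_trm:
  assumes "wf_trm (lang_const L A) t" "\<forall>a\<in>A. eval (struct_const C) e (c a) = a"
  shows "eval (struct_const C) e (subst_trm s c t)
    = eval (struct_const C) (\<lambda>v. eval (struct_const C) e (s v)) t"
  using assms
proof (induction s c t rule: subst_trm.induct)
  case (2 s c f ts)
  then have "map (eval (struct_const C) e) (map (subst_trm s c) ts)
      = map (eval (struct_const C) (\<lambda>v. eval (struct_const C) e (s v))) ts"
    by (auto simp: wf_trm_Fn_const simp del: wf_trm.simps)
  then show ?case by (simp only: subst_trm.simps eval.simps)
qed (auto simp: wf_trm_Fn_const simp del: wf_trm.simps)

text \<open>Substitution in a formula has to rename bound variables. It is therefore stated as the
  existence of a formula with the right meaning. The infinite set of variables outside \<open>X\<close>, which
  do not occur in the terms \<open>c a\<close>, supplies the new bound variables.\<close>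

lemma exists_substituted_formula:
  fixes \<phi> :: "('f + 'm, 'r, 'v) fm" and s :: "'v \<Rightarrow> ('f + 'm, 'w) trm"
  assumes "wf_fm (lang_const L A) \<phi>"
    and "\<forall>v\<in>fv \<phi>. wf_trm (lang_const L B) (s v)"
    and c: "\<forall>a\<in>A. wf_trm (lang_const L B) (c a)" "\<forall>a\<in>A. fv_trm (c a) \<subseteq> X"
    and inf: "infinite (- X)"
  shows "\<exists>\<psi>. wf_fm (lang_const L B) \<psi> \<and> fv \<psi> \<subseteq> (\<Union>v\<in>fv \<phi>. fv_trm (s v)) \<union> X \<and>
    (\<forall>e. (\<forall>a\<in>A. eval (struct_const C) e (c a) = a) \<longrightarrow>
      sat (struct_const C) e \<psi> = sat (struct_const C) (\<lambda>v. eval (struct_const C) e (s v)) \<phi>)"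
    (is "\<exists>\<psi>. ?subst s \<phi> \<psi>")
  using assms(1,2)
proof (induction \<phi> arbitrary: s)
  case (Eq t u)
  have tu: "wf_trm (lang_const L A) t" "wf_trm (lang_const L A) u"
    "\<forall>v\<in>fv_trm t. wf_trm (lang_const L B) (s v)" "\<forall>v\<in>fv_trm u. wf_trm (lang_const L B) (s v)"
    using Eq by auto
  have "fv_trm (subst_trm s c t) \<subseteq> (\<Union>v\<in>fv_trm t. fv_trm (s v)) \<union> X"
    "fv_trm (subst_trm s c u) \<subseteq> (\<Union>v\<in>fv_trm u. fv_trm (s v)) \<union> X"
    by (rule fv_subst_trm[OF _ c(2)], rule tu)+
  moreover have "sat (struct_const C) e (Eq (subst_trm s c t) (subst_trm s c u))
      = sat (struct_const C) (\<lambda>v. eval (struct_const C) e (s v)) (Eq t u)"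
    if "\<forall>a\<in>A. eval (struct_const C) e (c a) = a" for e
    by (simp only: sat.simps eval_subst_trm[OF tu(1) that] eval_subst_trm[OF tu(2) that])
  ultimately have "?subst s (Eq t u) (Eq (subst_trm s c t) (subst_trm s c u))"
    using wf_subst_trm[OF tu(1,3) c(1)] wf_subst_trm[OF tu(2,4) c(1)]
    by auto
  then show ?case by blast
next
  case (Rel r ts)
  have ts: "wf_trm (lang_const L A) t" "\<forall>v\<in>fv_trm t. wf_trm (lang_const L B) (s v)"
    if "t \<in> set ts" for t
    using Rel that by auto
  have "fv (Rel r (map (subst_trm s c) ts)) \<subseteq> (\<Union>v\<in>fv (Rel r ts). fv_trm (s v)) \<union> X"
    using fv_subst_trm[OF ts(1) c(2)] by fastforce
  moreover have "wf_fm (lang_const L B) (Rel r (map (subst_trm s c) ts))"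
    using Rel.prems(1) wf_subst_trm[OF ts c(1)] by (auto simp: lang_const_def)
  moreover have "map (eval (struct_const C) e) (map (subst_trm s c) ts)
      = map (eval (struct_const C) (\<lambda>v. eval (struct_const C) e (s v))) ts"
    if "\<forall>a\<in>A. eval (struct_const C) e (c a) = a" for e
    using eval_subst_trm[OF ts(1) that] by auto
  then have "sat (struct_const C) e (Rel r (map (subst_trm s c) ts))
      = sat (struct_const C) (\<lambda>v. eval (struct_const C) e (s v)) (Rel r ts)"
    if "\<forall>a\<in>A. eval (struct_const C) e (c a) = a" for e
    using that by (simp only: sat.simps)
  ultimately show ?case by blast
next
  case (Neg \<phi>)
  have "\<exists>\<psi>. ?subst s \<phi> \<psi>" by (rule Neg.IH) (use Neg.prems in auto)
  then obtain \<psi> where "?subst s \<phi> \<psi>" by blast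
  then have "?subst s (Neg \<phi>) (Neg \<psi>)" by simp
  then show ?case by blast
next
  case (Conj \<phi>1 \<phi>2)
  have "\<exists>\<psi>. ?subst s \<phi>1 \<psi>" by (rule Conj.IH(1)) (use Conj.prems in auto)
  moreover have "\<exists>\<psi>. ?subst s \<phi>2 \<psi>" by (rule Conj.IH(2)) (use Conj.prems in auto)
  ultimately obtain \<psi>1 \<psi>2 where "?subst s \<phi>1 \<psi>1" "?subst s \<phi>2 \<psi>2" by blast
  then have "?subst s (Conj \<phi>1 \<phi>2) (Conj \<psi>1 \<psi>2)" by auto
  then show ?case by blast
next
  case (Ex v \<phi>)
  define Y where "Y = (\<Union>u\<in>fv \<phi>. fv_trm (s u))"
  have "finite Y" unfolding Y_def by (simp add: finite_fv finite_fv_trm)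
  then obtain w where w: "w \<notin> X" "w \<notin> Y"
    using infinite_imp_nonempty[OF Diff_infinite_finite[OF _ inf, of Y]] by blast
  have "\<exists>\<psi>. ?subst (s(v := Var w)) \<phi> \<psi>"
    by (rule Ex.IH) (use Ex.prems in auto)
  then obtain \<psi> where \<psi>: "?subst (s(v := Var w)) \<phi> \<psi>" by blast
  have "fv (Ex w \<psi>) \<subseteq> (\<Union>u\<in>fv (Ex v \<phi>). fv_trm (s u)) \<union> X"
    using \<psi> by (fastforce split: if_splits)
  moreover have "sat (struct_const C) e (Ex w \<psi>)
      = sat (struct_const C) (\<lambda>u. eval (struct_const C) e (s u)) (Ex v \<phi>)"
    if e: "\<forall>a\<in>A. eval (struct_const C) e (c a) = a" for e
  proof -
    have "sat (struct_const C) (e(w := x)) \<psi>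
        = sat (struct_const C) ((\<lambda>u. eval (struct_const C) e (s u))(v := x)) \<phi>" for x
    proof -
      have "eval (struct_const C) (e(w := x)) (c a) = eval (struct_const C) e (c a)"
        if "a \<in> A" for a
        by (rule eval_cong) (use that w(1) c(2) in auto)
      then have "\<forall>a\<in>A. eval (struct_const C) (e(w := x)) (c a) = a"
        using e by simp
      then have "sat (struct_const C) (e(w := x)) \<psi>
          = sat (struct_const C) (\<lambda>u. eval (struct_const C) (e(w := x)) ((s(v := Var w)) u)) \<phi>"
        using \<psi> by blast
      also have "\<dots> = sat (struct_const C) ((\<lambda>u. eval (struct_const C) e (s u))(v := x)) \<phi>"
      proof (rule sat_cong)
        fix u assume "u \<in> fv \<phi>"
        then have "w \<notin> fv_trm (s u)" using w(2) Y_def by blast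
        then have "eval (struct_const C) (e(w := x)) (s u) = eval (struct_const C) e (s u)"
          by (intro eval_cong) auto
        then show "eval (struct_const C) (e(w := x)) ((s(v := Var w)) u)
            = ((\<lambda>u. eval (struct_const C) e (s u))(v := x)) u"
          by simp
      qed
      finally show ?thesis .
    qed
    then show ?thesis by (simp add: struct_const_def)
  qed
  ultimately have "?subst s (Ex v \<phi>) (Ex w \<psi>)" using \<psi> by simp
  then show ?case by blast
qed

section \<open>Types of partial tuples\<close>

lemma holds_at_simps [simp]:
  "holds_at S b (Neg \<phi>) \<longleftrightarrow> \<not> holds_at S b \<phi>"
  "holds_at S b (Conj \<phi> \<psi>) \<longleftrightarrow> holds_at S b \<phi> \<and> holds_at S b \<psi>"
  by (simp_all add: holds_at_def)

lemma holds_at_Ex: "holds_at S b (Ex (Inl i) \<phi>) \<longleftrightarrow> (\<exists>x\<in>univ S. holds_at S (b(i := x)) \<phi>)"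
proof -
  have "(case_sum b (\<lambda>_ :: nat. undefined))(Inl i := x) = case_sum (b(i := x)) (\<lambda>_. undefined)" for x
    by (auto simp: fun_eq_iff split: sum.splits)
  then show ?thesis by (simp add: holds_at_def struct_const_def)
qed

lemma complete_typesD:
  assumes "q \<in> complete_types L S A I"
  shows "q \<subseteq> formulas_over L A I"
    and "q0 \<subseteq> q \<Longrightarrow> finite q0 \<Longrightarrow> \<exists>b. b ` I \<subseteq> univ S \<and> realizes S b q0"
    and "\<phi> \<in> formulas_over L A I \<Longrightarrow> \<phi> \<in> q \<or> Neg \<phi> \<in> q"
  using assms unfolding complete_types_def by blast+

text \<open>The tuple \<open>b\<close>, restricted to \<open>J\<close>, satisfies the restriction of \<open>q\<close> to the variables indexed by
  \<open>J\<close>. The values of \<open>b\<close> outside \<open>J\<close> do not matter.\<close>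

definition realizes_on ::
    "('f, 'r, 'm) fo_struct \<Rightarrow> 'i set \<Rightarrow> ('i \<Rightarrow> 'm) \<Rightarrow> ('f + 'm, 'r, 'i + nat) fm set \<Rightarrow> bool" where
  "realizes_on S J b q \<longleftrightarrow> (\<forall>\<phi>\<in>q. fv \<phi> \<subseteq> Inl ` J \<longrightarrow> holds_at S b \<phi>)"

lemma realizes_on_finite_character:
  "realizes_on S J b q \<longleftrightarrow> (\<forall>J0. finite J0 \<and> J0 \<subseteq> J \<longrightarrow> realizes_on S J0 b q)"
proof
  assume "realizes_on S J b q"
  then show "\<forall>J0. finite J0 \<and> J0 \<subseteq> J \<longrightarrow> realizes_on S J0 b q"
    unfolding realizes_on_def by (meson image_mono subset_trans)
next
  assume fin: "\<forall>J0. finite J0 \<and> J0 \<subseteq> J \<longrightarrow> realizes_on S J0 b q"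
  show "realizes_on S J b q"
    unfolding realizes_on_def
  proof (intro ballI impI)
    fix \<phi> assume "\<phi> \<in> q" "fv \<phi> \<subseteq> Inl ` J"
    obtain J0 where "J0 \<subseteq> J" "finite J0" "fv \<phi> = Inl ` J0"
      using finite_subset_image[OF finite_fv \<open>fv \<phi> \<subseteq> Inl ` J\<close>] by blast
    then show "holds_at S b \<phi>"
      using fin[rule_format, of J0] \<open>\<phi> \<in> q\<close> by (simp add: realizes_on_def)
  qed
qed

text \<open>If \<open>\<theta>\<close> is the conjunction of \<open>\<Phi>\<close>, then \<open>q\<close> contains \<open>\<exists>x\<^sub>i. \<theta>\<close>, since it is complete and finitely
  satisfiable. The free variables of this formula are indexed by \<open>J\<close>, so \<open>b\<close> satisfies it.\<close>

lemma exists_next_coordinate: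
  fixes q :: "('f + 'm, 'r, 'i + nat) fm set"
  assumes q: "q \<in> complete_types L C A I" and "J \<subseteq> I" and i: "i \<in> I"
    and b: "realizes_on C J b q"
    and \<Phi>: "finite \<Phi>" "\<Phi> \<subseteq> q" "\<And>\<phi>. \<phi> \<in> \<Phi> \<Longrightarrow> fv \<phi> \<subseteq> Inl ` insert i J"
  shows "\<exists>x\<in>univ C. \<forall>\<phi>\<in>\<Phi>. holds_at C (b(i := x)) \<phi>"
proof -
  obtain \<phi>s where \<phi>s: "set \<phi>s = \<Phi>" using finite_list[OF \<Phi>(1)] by blast
  \<comment> \<open>The trivial equation serves as the empty conjunction.\<close>
  define \<theta> where "\<theta> = foldr Conj \<phi>s (Eq (Var (Inl i)) (Var (Inl i)))"
  have \<theta>: "holds_at C b' \<theta> \<longleftrightarrow> (\<forall>\<phi>\<in>\<Phi>. holds_at C b' \<phi>)" for b'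
  proof -
    have "holds_at C b' (foldr Conj xs (Eq (Var (Inl i)) (Var (Inl i))))
        \<longleftrightarrow> (\<forall>\<phi>\<in>set xs. holds_at C b' \<phi>)" for xs
      by (induction xs) (auto simp: holds_at_def)
    then show ?thesis by (simp add: \<theta>_def \<phi>s)
  qed
  have "fv (foldr Conj xs (Eq (Var (Inl i)) (Var (Inl i)))) = insert (Inl i) (\<Union>\<phi>\<in>set xs. fv \<phi>)"
    for xs :: "('f + 'm, 'r, 'i + nat) fm list"
    by (induction xs) auto
  then have fv: "fv (Ex (Inl i) \<theta>) \<subseteq> Inl ` J"
    using \<Phi>(3) by (auto simp: \<theta>_def \<phi>s)
  have "wf_fm (lang_const L A) (foldr Conj xs (Eq (Var (Inl i)) (Var (Inl i))))"
    if "set xs \<subseteq> q" for xs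
    using that complete_typesD(1)[OF q] by (induction xs) (auto simp: formulas_over_def)
  then have "wf_fm (lang_const L A) \<theta>" using \<Phi>(2) \<phi>s by (simp add: \<theta>_def)
  then have "Ex (Inl i) \<theta> \<in> formulas_over L A I"
    using fv \<open>J \<subseteq> I\<close> by (auto simp: formulas_over_def)
  moreover have "Neg (Ex (Inl i) \<theta>) \<notin> q"
  proof
    assume "Neg (Ex (Inl i) \<theta>) \<in> q"
    then obtain b' where b': "b' ` I \<subseteq> univ C" "realizes C b' (insert (Neg (Ex (Inl i) \<theta>)) \<Phi>)"
      using complete_typesD(2)[OF q, of "insert (Neg (Ex (Inl i) \<theta>)) \<Phi>"] \<Phi> by auto
    then have "holds_at C (b'(i := b' i)) \<theta>" "b' i \<in> univ C"
      using i by (auto simp: realizes_def \<theta>)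
    then show False using b'(2) by (auto simp: realizes_def holds_at_Ex)
  qed
  ultimately have "Ex (Inl i) \<theta> \<in> q" using complete_typesD(3)[OF q] by blast
  then have "holds_at C b (Ex (Inl i) \<theta>)" using b fv unfolding realizes_on_def by blast
  then show ?thesis by (simp add: holds_at_Ex \<theta>)
qed

text \<open>The \<open>1\<close>-type over \<open>A \<union> b(J)\<close> obtained from the formulas of \<open>q\<close> in the variables indexed by
  \<open>J \<union> {i}\<close> by substituting \<open>b\<close> for the variables indexed by \<open>J\<close>. The result of the substitution is
  described up to equivalence in \<open>C\<close>, which avoids the renaming of bound variables and the choice
  of an index in \<open>J\<close> for each parameter in \<open>b(J)\<close>.\<close>

definition next_type ::
    "('f, 'r) lang \<Rightarrow> ('f, 'r, 'm) fo_struct \<Rightarrow> 'm set \<Rightarrow> 'i set \<Rightarrow> ('i \<Rightarrow> 'm) \<Rightarrow> 'i \<Rightarrow>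
     ('f + 'm, 'r, 'i + nat) fm set \<Rightarrow> ('f + 'm, 'r, unit + nat) fm set" where
  "next_type L C A J b i q = {\<psi> \<in> formulas_over L (A \<union> b ` J) UNIV.
     \<exists>\<phi>\<in>q. fv \<phi> \<subseteq> Inl ` insert i J \<and>
       (\<forall>x. holds_at C (\<lambda>_. x) \<psi> \<longleftrightarrow> holds_at C (b(i := x)) \<phi>)}"

text \<open>A parameter in \<open>b(J) - A\<close> is replaced by a variable \<open>Inl j\<close> with \<open>b j\<close> equal to it. Changing \<open>b\<close> at
  \<open>i\<close> does not affect the meaning of this variable, because \<open>i \<notin> J\<close>.\<close>

lemma parameters_to_variables:
  fixes \<psi> :: "('f + 'm, 'r, unit + nat) fm" and i :: 'i
  assumes "\<psi> \<in> formulas_over L (A \<union> b ` J) (UNIV :: unit set)" and "i \<notin> J"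
  shows "\<exists>\<phi>\<in>formulas_over L A (insert i J).
    \<forall>x. holds_at C (\<lambda>_. x) \<psi> \<longleftrightarrow> holds_at C (b(i := x)) \<phi>"
proof -
  define c :: "'m \<Rightarrow> ('f + 'm, 'i + nat) trm"
    where "c a = (if a \<in> A then Fn (Inr a) [] else Var (Inl (inv_into J b a)))" for a
  have "infinite (- Inl ` J :: ('i + nat) set)"
  proof -
    have "range Inr \<subseteq> (- Inl ` J :: ('i + nat) set)" by auto
    then show ?thesis by (meson finite_imageD finite_subset infinite_UNIV_nat inj_Inr)
  qed
  moreover have "\<forall>a\<in>A \<union> b ` J. wf_trm (lang_const L A) (c a)"
    by (auto simp: c_def lang_const_def)
  moreover have "\<forall>a\<in>A \<union> b ` J. fv_trm (c a) \<subseteq> Inl ` J"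
    by (auto simp: c_def inv_into_into)
  moreover have "wf_fm (lang_const L (A \<union> b ` J)) \<psi>" "fv \<psi> \<subseteq> Inl ` UNIV"
    using assms(1) by (auto simp: formulas_over_def)
  ultimately obtain \<phi> where \<phi>: "wf_fm (lang_const L A) \<phi>"
      "fv \<phi> \<subseteq> (\<Union>v\<in>fv \<psi>. fv_trm (Var (Inl i))) \<union> Inl ` J"
      "\<forall>e. (\<forall>a\<in>A \<union> b ` J. eval (struct_const C) e (c a) = a) \<longrightarrow>
         sat (struct_const C) e \<phi> = sat (struct_const C) (\<lambda>v. eval (struct_const C) e (Var (Inl i))) \<psi>"
    using exists_substituted_formula[of L "A \<union> b ` J" \<psi> A "\<lambda>_. Var (Inl i)" c "Inl ` J" C]
    by auto
  have "holds_at C (\<lambda>_. x) \<psi> \<longleftrightarrow> holds_at C (b(i := x)) \<phi>" for x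
  proof -
    define e where "e = case_sum (b(i := x)) (\<lambda>_ :: nat. undefined)"
    have "eval (struct_const C) e (c a) = a" if "a \<in> A \<union> b ` J" for a
    proof (cases "a \<in> A")
      case False
      then have "a \<in> b ` J" using that by blast
      then have "inv_into J b a \<in> J" "b (inv_into J b a) = a"
        by (simp_all add: inv_into_into f_inv_into_f)
      then show ?thesis using False \<open>i \<notin> J\<close> by (auto simp: c_def e_def)
    qed (simp add: c_def)
    then have "sat (struct_const C) e \<phi>
        = sat (struct_const C) (\<lambda>v. eval (struct_const C) e (Var (Inl i))) \<psi>"
      using \<phi>(3) by blast
    moreover have "\<dots> = sat (struct_const C) (case_sum (\<lambda>_. x) (\<lambda>_. undefined)) \<psi>"
      by (rule sat_cong) (use \<open>fv \<psi> \<subseteq> Inl ` UNIV\<close> in \<open>auto simp: e_def\<close>)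
    ultimately show ?thesis by (simp add: holds_at_def e_def)
  qed
  moreover have "\<phi> \<in> formulas_over L A (insert i J)"
    using \<phi>(1,2) by (auto simp: formulas_over_def split: if_splits)
  ultimately show ?thesis by blast
qed

lemma variables_to_parameters:
  fixes \<phi> :: "('f + 'm, 'r, 'i + nat) fm"
  assumes "\<phi> \<in> formulas_over L A (insert i J)"
  shows "\<exists>\<psi>\<in>formulas_over L (A \<union> b ` J) (UNIV :: unit set).
    \<forall>x. holds_at C (\<lambda>_. x) \<psi> \<longleftrightarrow> holds_at C (b(i := x)) \<phi>"
proof -
  define s :: "'i + nat \<Rightarrow> ('f + 'm, unit + nat) trm"
    where "s = case_sum (\<lambda>j. if j = i then Var (Inl ()) else Fn (Inr (b j)) []) (\<lambda>n. Var (Inr n))"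
  have \<phi>: "wf_fm (lang_const L A) \<phi>" and fv: "fv \<phi> \<subseteq> Inl ` insert i J"
    using assms by (auto simp: formulas_over_def)
  have "wf_trm (lang_const L (A \<union> b ` J)) (s v)" if "v \<in> fv \<phi>" for v
    using that fv by (auto simp: s_def lang_const_def)
  moreover have "infinite (- {} :: (unit + nat) set)"
    by simp
  ultimately obtain \<psi> where \<psi>: "wf_fm (lang_const L (A \<union> b ` J)) \<psi>"
      "fv \<psi> \<subseteq> (\<Union>v\<in>fv \<phi>. fv_trm (s v))"
      "\<forall>e. sat (struct_const C) e \<psi> = sat (struct_const C) (\<lambda>v. eval (struct_const C) e (s v)) \<phi>"
    using exists_substituted_formula[OF \<phi>, of "A \<union> b ` J" s "\<lambda>a. Fn (Inr a) []" "{}" C]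
    by (auto simp: wf_trm_Fn_const simp del: wf_trm.simps)
  have "holds_at C (\<lambda>_. x) \<psi> \<longleftrightarrow> holds_at C (b(i := x)) \<phi>" for x
    unfolding holds_at_def \<psi>(3)[rule_format]
    by (rule sat_cong) (use fv in \<open>auto simp: s_def\<close>)
  moreover have "fv \<psi> \<subseteq> Inl ` UNIV"
    using \<psi>(2) fv by (fastforce simp: s_def split: if_splits)
  ultimately show ?thesis using \<psi>(1) by (auto simp: formulas_over_def)
qed

lemma next_type_complete:
  assumes q: "q \<in> complete_types L C A I" and J: "J \<subseteq> I" "i \<in> I" "i \<notin> J"
    and b: "realizes_on C J b q"
  shows "next_type L C A J b i q \<in> complete_types L C (A \<union> b ` J) UNIV"
  unfolding complete_types_def mem_Collect_eq
proof (intro conjI allI ballI impI)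
  show "next_type L C A J b i q \<subseteq> formulas_over L (A \<union> b ` J) UNIV"
    by (auto simp: next_type_def)
next
  fix p0 assume p0: "p0 \<subseteq> next_type L C A J b i q \<and> finite p0"
  then have "\<forall>\<psi>\<in>p0. \<exists>\<phi>\<in>q. fv \<phi> \<subseteq> Inl ` insert i J \<and>
       (\<forall>x. holds_at C (\<lambda>_. x) \<psi> \<longleftrightarrow> holds_at C (b(i := x)) \<phi>)"
    unfolding next_type_def by blast
  then obtain f where f: "\<forall>\<psi>\<in>p0. f \<psi> \<in> q \<and> fv (f \<psi>) \<subseteq> Inl ` insert i J \<and>
       (\<forall>x. holds_at C (\<lambda>_. x) \<psi> \<longleftrightarrow> holds_at C (b(i := x)) (f \<psi>))"
    by metis
  then obtain x where "x \<in> univ C" "\<forall>\<phi>\<in>f ` p0. holds_at C (b(i := x)) \<phi>"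
    using exists_next_coordinate[OF q J(1,2) b, of "f ` p0"] p0 by blast
  then have "(\<lambda>_. x) ` UNIV \<subseteq> univ C \<and> realizes C (\<lambda>_. x) p0"
    using f by (auto simp: realizes_def)
  then show "\<exists>d. d ` UNIV \<subseteq> univ C \<and> realizes C d p0" by (intro exI[of _ "\<lambda>_. x"])
next
  fix \<psi> assume \<psi>: "\<psi> \<in> formulas_over L (A \<union> b ` J) (UNIV :: unit set)"
  then obtain \<phi> where \<phi>: "\<phi> \<in> formulas_over L A (insert i J)"
      "\<forall>x. holds_at C (\<lambda>_. x) \<psi> \<longleftrightarrow> holds_at C (b(i := x)) \<phi>"
    using parameters_to_variables[OF _ J(3)] by metis
  have "Inl ` insert i J \<subseteq> Inl ` I" using J by blast
  then have "\<phi> \<in> formulas_over L A I"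
    using \<phi>(1) unfolding formulas_over_def by (blast intro: order_trans)
  then consider "\<phi> \<in> q" | "Neg \<phi> \<in> q" using complete_typesD(3)[OF q] by blast
  then show "\<psi> \<in> next_type L C A J b i q \<or> Neg \<psi> \<in> next_type L C A J b i q"
  proof cases
    case 1
    then show ?thesis using \<phi> \<psi> by (auto simp: next_type_def formulas_over_def)
  next
    case 2
    moreover have "Neg \<psi> \<in> formulas_over L (A \<union> b ` J) UNIV" "fv (Neg \<phi>) \<subseteq> Inl ` insert i J"
      using \<phi>(1) \<psi> by (auto simp: formulas_over_def)
    moreover have "\<forall>x. holds_at C (\<lambda>_. x) (Neg \<psi>) \<longleftrightarrow> holds_at C (b(i := x)) (Neg \<phi>)"
      using \<phi>(2) by simp
    ultimately show ?thesis unfolding next_type_def by blast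
  qed
qed

lemma realizes_next_type:
  assumes q: "q \<in> complete_types L C A I"
    and d: "realizes C (\<lambda>_. d) (next_type L C A J b i q)"
  shows "realizes_on C (insert i J) (b(i := d)) q"
  unfolding realizes_on_def
proof (intro ballI impI)
  fix \<phi> assume \<phi>: "\<phi> \<in> q" "fv \<phi> \<subseteq> Inl ` insert i J"
  then have "\<phi> \<in> formulas_over L A (insert i J)"
    using complete_typesD(1)[OF q] by (auto simp: formulas_over_def)
  then obtain \<psi> where \<psi>: "\<psi> \<in> formulas_over L (A \<union> b ` J) (UNIV :: unit set)"
      "\<forall>x. holds_at C (\<lambda>_. x) \<psi> \<longleftrightarrow> holds_at C (b(i := x)) \<phi>"
    using variables_to_parameters by metis
  then have "\<psi> \<in> next_type L C A J b i q" using \<phi> by (auto simp: next_type_def)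
  then have "holds_at C (\<lambda>_. d) \<psi>" by (rule bspec[OF d[unfolded realizes_def]])
  then show "holds_at C (b(i := d)) \<phi>" by (rule iffD1[OF \<psi>(2)[rule_format]])
qed

section \<open>Independence\<close>

lemma
  assumes "independence_relation L \<mu> C ind"
    and "A \<subseteq> univ C" "small \<mu> A" "B \<subseteq> univ C" "small \<mu> B" "D \<subseteq> univ C" "small \<mu> D"
  shows ind_normality: "ind A B D \<Longrightarrow> ind (A \<union> B) B D"
    and ind_symmetry: "ind A B D \<Longrightarrow> ind D B A"
    and ind_finite_character: "ind A B D \<longleftrightarrow> (\<forall>A0. A0 \<subseteq> A \<and> finite A0 \<longrightarrow> ind A0 B D)"
    and ind_extension: "\<exists>g. g ` A \<subseteq> univ C \<and> tp L C B A g = tp L C B A id \<and> ind (g ` A) B D"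
proof -
  note axs = assms(1)[unfolded independence_relation_def Let_def, THEN conjunct2]
  show "ind A B D \<Longrightarrow> ind (A \<union> B) B D"
    using axs[THEN conjunct1] assms(2-) by blast
  note axs = axs[THEN conjunct2]
  show "ind A B D \<Longrightarrow> ind D B A"
    using axs[THEN conjunct1] assms(2-) by blast
  note axs = axs[THEN conjunct2, THEN conjunct2]
  show "ind A B D \<longleftrightarrow> (\<forall>A0. A0 \<subseteq> A \<and> finite A0 \<longrightarrow> ind A0 B D)"
    using axs[THEN conjunct1, rule_format, of A B D] assms(2-) by blast
  show "\<exists>g. g ` A \<subseteq> univ C \<and> tp L C B A g = tp L C B A id \<and> ind (g ` A) B D"
    using axs[THEN conjunct2, THEN conjunct1, rule_format, of A B D] assms(2-) by blast
qed

lemma ind_transitivity: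
  assumes "independence_relation L \<mu> C ind"
    and "A \<subseteq> univ C" "small \<mu> A" "B \<subseteq> univ C" "small \<mu> B" "D \<subseteq> univ C" "small \<mu> D"
      "E \<subseteq> univ C" "small \<mu> E"
    and "B \<subseteq> D" "D \<subseteq> E"
  shows "ind A B E \<longleftrightarrow> ind A B D \<and> ind A D E"
  using assms(1)[unfolded independence_relation_def Let_def, THEN conjunct2, THEN conjunct2,
    THEN conjunct2, THEN conjunct1, rule_format, of A B D E] assms(2-) by blast

lemma ind_empty:
  fixes ind :: "'m set \<Rightarrow> 'm set \<Rightarrow> 'm set \<Rightarrow> bool"
  assumes "independence_relation L \<mu> C ind"
    and "B \<subseteq> univ C" "small \<mu> B" "D \<subseteq> univ C" "small \<mu> D"
  shows "ind {} B D"
proof -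
  have "small \<mu> ({} :: 'm set)"
    using assms(3) unfolding small_def by (meson card_of_empty ordLeq_ordLess_trans)
  then show ?thesis
    using ind_extension[OF assms(1), of "{}" B D] assms(2-5) by simp
qed

text \<open>Left transitivity for adding one element. Transitivity is an axiom for the right-hand side, so
  it is applied to \<open>D\<close> and the chain \<open>A \<subseteq> A \<union> B \<subseteq> A \<union> B \<union> {d}\<close> between two uses of symmetry;
  normality makes the right-hand sides contain the bases.\<close>

lemma ind_insert:
  assumes ind: "independence_relation L \<mu> C ind"
    and U: "U \<subseteq> univ C" "small \<mu> U" and sub: "A \<subseteq> U" "B \<subseteq> U" "D \<subseteq> U" "d \<in> U"
    and B: "ind B A D" and d: "ind {d} (A \<union> B) D"
  shows "ind (insert d B) A D"
proof -
  have sm: "X \<subseteq> univ C" "small \<mu> X" if "X \<subseteq> U" for X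
    using U that unfolding small_def by (auto intro: ordLeq_ordLess_trans card_of_mono1)
  define W where "W = {d} \<union> (A \<union> B)"
  have W: "W \<subseteq> U" "A \<union> B \<subseteq> W" "A \<union> B \<subseteq> U" "{d} \<subseteq> U" "insert d B \<subseteq> U" "insert d B \<subseteq> W"
    using sub by (auto simp: W_def)
  note smU = sm[OF sub(1)] sm[OF sub(2)] sm[OF sub(3)] sm[OF W(1)] sm[OF W(3)] sm[OF W(4)]
    sm[OF W(5)]
  have "ind (A \<union> B) A D"
    using ind_normality[OF ind _ _ _ _ _ _ B] smU by (simp add: Un_commute)
  then have "ind D A (A \<union> B)" by (rule ind_symmetry[OF ind, rotated 6]) (rule smU)+
  moreover have "ind W (A \<union> B) D"
    unfolding W_def by (rule ind_normality[OF ind _ _ _ _ _ _ d]) (rule smU)+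
  then have "ind D (A \<union> B) W" by (rule ind_symmetry[OF ind, rotated 6]) (rule smU)+
  ultimately have "ind D A W"
    using ind_transitivity[OF ind, of D A "A \<union> B" W] smU W(2) by blast
  then have "ind W A D" by (rule ind_symmetry[OF ind, rotated 6]) (rule smU)+
  then show ?thesis
    using ind_finite_character[OF ind, of W A D] ind_finite_character[OF ind, of "insert d B" A D]
      smU W(6) by (meson order_trans)
qed

section \<open>Construction of tuples by finite character\<close>

text \<open>A form of the Teichmueller-Tukey lemma: if a property \<open>Q J b\<close> of partial functions \<open>b\<close> on
  subsets \<open>J\<close> of \<open>I\<close> has finite character and each partial function with \<open>Q\<close> can be extended by
  one point, then there is a function on \<open>I\<close> with \<open>Q\<close>.\<close>

lemma exists_total_of_finite_character:
  fixes Q :: "'i set \<Rightarrow> ('i \<Rightarrow> 'm) \<Rightarrow> bool"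
  assumes cong: "\<And>J b b'. (\<And>j. j \<in> J \<Longrightarrow> b j = b' j) \<Longrightarrow> Q J b \<Longrightarrow> Q J b'"
    and fin: "\<And>J b. J \<subseteq> I \<Longrightarrow> Q J b \<longleftrightarrow> (\<forall>J0. finite J0 \<and> J0 \<subseteq> J \<longrightarrow> Q J0 b)"
    and base: "\<And>b. Q {} b"
    and step: "\<And>J b i. J \<subseteq> I \<Longrightarrow> i \<in> I \<Longrightarrow> i \<notin> J \<Longrightarrow> Q J b \<Longrightarrow> \<exists>d. Q (insert i J) (b(i := d))"
  shows "\<exists>b. Q I b"
proof -
  define gr where "gr J b = (\<lambda>j. (j, b j)) ` J" for J and b :: "'i \<Rightarrow> 'm"
  \<comment> \<open>Zorn's lemma is applied to graphs, which are ordered by inclusion exactly as the partial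
    functions are ordered by extension.\<close>
  define \<G> where "\<G> = {gr J b |J b. J \<subseteq> I \<and> Q J b}"
  have "gr {} undefined \<in> \<G>" using base unfolding \<G>_def by blast
  then have "\<G> \<noteq> {}" by blast
  moreover have "\<Union>\<C> \<in> \<G>" if \<C>: "\<C> \<noteq> {}" "subset.chain \<G> \<C>" for \<C>
  proof -
    have sub: "\<C> \<subseteq> \<G>" using \<C>(2) by (simp add: subset.chain_def)
    define J where "J = fst ` \<Union>\<C>"
    define b where "b j = (SOME d. (j, d) \<in> \<Union>\<C>)" for j
    have "J \<subseteq> I" using sub by (fastforce simp: J_def \<G>_def gr_def)
    have b_eq: "b j = d" if "(j, d) \<in> \<Union>\<C>" for j d
    proof -
      have "(j, b j) \<in> \<Union>\<C>" unfolding b_def by (rule someI[of _ d]) (rule that)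
      then have "{(j, b j), (j, d)} \<subseteq> \<Union>\<C>" using that by blast
      then obtain G where "G \<in> \<C>" "{(j, b j), (j, d)} \<subseteq> G"
        by (rule finite_subset_Union_chain[rotated]) (use \<C> in simp_all)
      then show ?thesis using sub by (auto simp: \<G>_def gr_def)
    qed
    have U: "\<Union>\<C> = gr J b"
      using b_eq by (force simp: gr_def J_def image_iff)
    have "Q J0 b" if J0: "finite J0" "J0 \<subseteq> J" for J0
    proof -
      have "finite (gr J0 b)" "gr J0 b \<subseteq> \<Union>\<C>" using J0 U by (auto simp: gr_def)
      then obtain G where G: "G \<in> \<C>" "gr J0 b \<subseteq> G"
        using finite_subset_Union_chain \<C> by metis
      then obtain J' b' where J': "G = gr J' b'" "J' \<subseteq> I" "Q J' b'"
        using sub by (auto simp: \<G>_def)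
      then have "J0 \<subseteq> J'" "\<And>j. j \<in> J0 \<Longrightarrow> b' j = b j"
        using G(2) by (auto simp: gr_def)
      moreover from this have "Q J0 b'" using fin[OF J'(2)] J'(3) J0(1) by blast
      ultimately show ?thesis using cong by blast
    qed
    then have "Q J b" using fin[OF \<open>J \<subseteq> I\<close>] by blast
    then show ?thesis using U \<open>J \<subseteq> I\<close> unfolding \<G>_def by blast
  qed
  ultimately obtain G where G: "G \<in> \<G>" "\<And>G'. G' \<in> \<G> \<Longrightarrow> G \<subseteq> G' \<Longrightarrow> G' = G"
    using subset_Zorn_nonempty[of \<G>] by blast
  then obtain J b where J: "G = gr J b" "J \<subseteq> I" "Q J b" by (auto simp: \<G>_def)
  have "i \<in> J" if "i \<in> I" for i
  proof (rule ccontr)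
    assume "i \<notin> J"
    then obtain d where "Q (insert i J) (b(i := d))" using step J(2,3) \<open>i \<in> I\<close> by blast
    then have "gr (insert i J) (b(i := d)) \<in> \<G>" using J(2) \<open>i \<in> I\<close> unfolding \<G>_def by blast
    moreover have "G \<subseteq> gr (insert i J) (b(i := d))" using \<open>i \<notin> J\<close> J(1) by (auto simp: gr_def)
    ultimately have "gr (insert i J) (b(i := d)) = gr J b" using G(2) J(1) by blast
    then show False using \<open>i \<notin> J\<close> by (auto simp: gr_def)
  qed
  then have "J = I" using J(2) by blast
  then show ?thesis using J(3) by blast
qed

section \<open>The Extension Property for tuples\<close>

theorem lemma5p2:
  fixes L :: "('f, 'r) lang"
    and T :: "('f, 'r, nat) fm set"
    and \<mu> \<kappa>\<^sub>0 \<kappa> :: "'k rel"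
    and C :: "('f, 'r, 'm) fo_struct"
    and ind :: "'m set \<Rightarrow> 'm set \<Rightarrow> 'm set \<Rightarrow> bool"
    and M\<^sub>P :: "('f, 'r option, 'm) fo_struct"
  assumes "complete_theory L T"
    and "monster_model L T \<mu> C"
    and "independence_relation L \<mu> C ind"
    and "is_kappa0 \<mu> C ind \<kappa>\<^sub>0"
    and "Card_order \<kappa>" and "\<kappa> <o \<mu>" and "\<kappa>\<^sub>0 <o \<kappa>" and "|T| <o \<kappa>"
    and "small_model_P L T \<mu> C M\<^sub>P"
    and "extension_property L C ind \<kappa> M\<^sub>P (UNIV :: unit set)"
  shows "\<forall>I :: 'i set. |I| <o \<kappa> \<longrightarrow> extension_property L C ind \<kappa> M\<^sub>P I"
proof (intro allI impI)
  fix I :: "'i set" assume I: "|I| <o \<kappa>"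
  let ?M = "univ M\<^sub>P" and ?P = "P_set M\<^sub>P"
  note indep = assms(3)
  have M: "?M \<subseteq> univ C" "small \<mu> ?M"
    using assms(9) by (auto simp: small_model_P_def elementary_substruct_def reduct_def)
  have P: "?P \<subseteq> ?M" by (auto simp: P_set_def)
  have sm: "X \<subseteq> univ C" "small \<mu> X" if "X \<subseteq> ?M" for X
    using M that unfolding small_def by (auto intro: ordLeq_ordLess_trans card_of_mono1)
  have "Cinfinite \<kappa>\<^sub>0" using assms(4) by (simp add: is_kappa0_def)
  then have "Cinfinite \<kappa>" using assms(5,7) by (meson cinfinite_mono ordLess_imp_ordLeq)
  then have very_small_Un: "|X \<union> Y| <o \<kappa>" if "|X| <o \<kappa>" "|Y| <o \<kappa>" for X Y :: "'m set"
    using that by (simp add: cinfinite_def card_of_Un_ordLess_infinite_Field)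
  show "extension_property L C ind \<kappa> M\<^sub>P I"
    unfolding extension_property_def
  proof (intro allI impI ballI)
    fix A and q :: "('f + 'm, 'r, 'i + nat) fm set"
    assume A: "A \<subseteq> ?M \<and> |A| <o \<kappa>" and q: "q \<in> complete_types L C A I"
    \<comment> \<open>the good partial tuples\<close>
    define Q where "Q J b \<longleftrightarrow> b ` J \<subseteq> ?M \<and> realizes_on C J b q \<and> ind (b ` J) A ?P" for J b
    have "\<exists>b. Q I b"
    proof (rule exists_total_of_finite_character)
      fix J and b b' :: "'i \<Rightarrow> 'm"
      assume eq: "\<And>j. j \<in> J \<Longrightarrow> b j = b' j" and "Q J b"
      moreover have "b ` J = b' ` J" using eq by auto
      ultimately show "Q J b'"
        using holds_at_cong[of _ J b b' C] unfolding Q_def realizes_on_def by metis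
    next
      fix J and b :: "'i \<Rightarrow> 'm"
      have "b ` J \<subseteq> ?M \<longleftrightarrow> (\<forall>J0. finite J0 \<and> J0 \<subseteq> J \<longrightarrow> b ` J0 \<subseteq> ?M)"
        unfolding image_subset_iff by (meson finite.intros insert_subset empty_subsetI subsetD insertI1)
      moreover have "ind (b ` J) A ?P \<longleftrightarrow> (\<forall>J0. finite J0 \<and> J0 \<subseteq> J \<longrightarrow> ind (b ` J0) A ?P)"
        if "b ` J \<subseteq> ?M"
      proof -
        have "ind (b ` J) A ?P \<longleftrightarrow> (\<forall>B0. B0 \<subseteq> b ` J \<and> finite B0 \<longrightarrow> ind B0 A ?P)"
          by (rule ind_finite_character[OF indep]) (use sm that A P in auto)
        also have "\<dots> \<longleftrightarrow> (\<forall>J0. finite J0 \<and> J0 \<subseteq> J \<longrightarrow> ind (b ` J0) A ?P)"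
          using all_finite_subset_image[of b J "\<lambda>B0. ind B0 A ?P"] by (simp add: conj_commute)
        finally show ?thesis .
      qed
      ultimately show "Q J b \<longleftrightarrow> (\<forall>J0. finite J0 \<and> J0 \<subseteq> J \<longrightarrow> Q J0 b)"
        unfolding Q_def realizes_on_finite_character[of C J b q] by meson
    next
      fix b :: "'i \<Rightarrow> 'm"
      have "realizes_on C {} b q"
        unfolding realizes_on_def
      proof (intro ballI impI)
        fix \<phi> assume \<phi>: "\<phi> \<in> q" "fv \<phi> \<subseteq> Inl ` {}"
        then obtain b' where "realizes C b' {\<phi>}"
          using complete_typesD(2)[OF q, of "{\<phi>}"] by auto
        then show "holds_at C b \<phi>"
          using holds_at_cong[OF \<phi>(2), of b b' C] by (simp add: realizes_def)
      qed
      moreover have "ind {} A ?P"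
        by (rule ind_empty[OF indep]) (use sm A P in auto)
      ultimately show "Q {} b" by (simp add: Q_def)
    next
      fix J i and b :: "'i \<Rightarrow> 'm"
      assume J: "J \<subseteq> I" "i \<in> I" "i \<notin> J" and "Q J b"
      then have b: "b ` J \<subseteq> ?M" "realizes_on C J b q" "ind (b ` J) A ?P"
        by (auto simp: Q_def)
      have "|b ` J| <o \<kappa>"
        using I J(1) by (meson card_of_image card_of_mono1 ordLeq_ordLess_trans)
      then have "|A \<union> b ` J| <o \<kappa>" "A \<union> b ` J \<subseteq> ?M" using very_small_Un A b(1) by auto
      then obtain d' :: "unit \<Rightarrow> 'm" where d': "d' ` UNIV \<subseteq> ?M"
          "realizes C d' (next_type L C A J b i q)" "ind (d' ` UNIV) (A \<union> b ` J) ?P"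
        using assms(10) next_type_complete[OF q J b(2)] unfolding extension_property_def by blast
      define d where "d = d' ()"
      have "d' = (\<lambda>_. d)" by (auto simp: d_def)
      with d' have d: "d \<in> ?M" "realizes C (\<lambda>_. d) (next_type L C A J b i q)"
          "ind {d} (A \<union> b ` J) ?P"
        by auto
      have im: "b(i := d) ` insert i J = insert d (b ` J)" using J(3) by auto
      have "ind (insert d (b ` J)) A ?P"
        by (rule ind_insert[OF indep M _ b(1) P d(1) b(3) d(3)]) (use A in blast)
      moreover have "realizes_on C (insert i J) (b(i := d)) q"
        by (rule realizes_next_type[OF q d(2)])
      ultimately have "Q (insert i J) (b(i := d))"
        using b(1) d(1) unfolding Q_def im by blast
      then show "\<exists>d. Q (insert i J) (b(i := d))" by blast
    qed
    then obtain b where b: "Q I b" by blast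
    have "realizes C b q"
      using b complete_typesD(1)[OF q] unfolding Q_def realizes_on_def realizes_def formulas_over_def
      by blast
    then show "\<exists>b. b ` I \<subseteq> ?M \<and> realizes C b q \<and> ind (b ` I) A ?P"
      using b unfolding Q_def by blast
  qed
qed

end
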